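(* For $r,s,t\in\mathbb{Z}$ let \[\phi_{(r,s,t)}(x)=\frac{rs\,x^3+s\,x+t}{x^2+1},\] and let $\beta_{(r,s,t)}=r^{n_1}s^{n_2}t^{n_3}$ where $n_1,n_2,n_3$ are integers with $\min\{n_1,n_2,n_3\}\geq6$. Then \[\limsup_{B\to\infty}\frac{\sum_{|r|,|s|,|t|\leq B}\#\Big(\mathcal{O}_{\phi_{(r,s,t)}}\big(\beta_{(r,s,t)}\big)\cap\mathbb{Z}\Big)}{(2B+1)^3}<\infty.\]
   Context: The sum is over integers $r,s,t$. $\mathcal{O}_\phi(b)=\{b,\phi(b),\phi^2(b),\dots\}$ is the forward orbit, and $\mathcal{O}_\phi(b)\cap\mathbb{Z}$ is the set of its points that are integers. *)

theory Defs
  imports "HOL-Analysis.Analysis"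
begin

(* Since x^2 + 1 has no rational zero, iterating from a rational point never meets
   the point at infinity, so phi is a total self-map of the rationals. *)
definition phi :: "int \<Rightarrow> int \<Rightarrow> int \<Rightarrow> rat \<Rightarrow> rat" where
  "phi r s t x =
     (of_int r * of_int s * x ^ 3 + of_int s * x + of_int t) / (x ^ 2 + 1)"

definition beta :: "int \<Rightarrow> int \<Rightarrow> int \<Rightarrow> int \<Rightarrow> int \<Rightarrow> int \<Rightarrow> rat" where
  "beta n1 n2 n3 r s t = of_int r powi n1 * of_int s powi n2 * of_int t powi n3"

definition forward_orbit :: "('a \<Rightarrow> 'a) \<Rightarrow> 'a \<Rightarrow> 'a set" where
  "forward_orbit f b = {(f ^^ n) b | n. True}"

(* Counting measure rather than card, which would give 0 for an infinite set. *)
definition num_points :: "'a set \<Rightarrow> ennreal" where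
  "num_points A = emeasure (count_space UNIV) A"

end

theory Submission
  imports Defs
begin

text \<open>
  If \<open>r s t \<noteq> 0\<close>, then \<open>\<beta>\<close> is so large compared with \<open>r, s, t\<close> that \<open>\<phi>(\<beta>)\<close> is not an integer,
  hence some prime \<open>p\<close> dividing \<open>\<beta>\<^sup>2 + 1\<close> occurs in its denominator. Such a \<open>p\<close> is coprime to \<open>\<beta>\<close>,
  hence to \<open>r s\<close>, and then it persists in the denominators of all further iterates: \<open>\<beta>\<close> is the only
  integer in its orbit. If \<open>t = 0\<close> the orbit is \<open>{0}\<close>. If \<open>r s = 0\<close> then \<open>|\<phi>| \<le> |s| + |t|\<close>, so
  the orbit of \<open>\<beta> = 0\<close> contains \<open>O(B)\<close> integers, and there are only \<open>O(B\<^sup>2)\<close> such triples.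
\<close>

section \<open>Primes in the denominators of rationals\<close>

text \<open>For prime \<open>p\<close> this says that the \<open>p\<close>-adic valuation of
  \<open>x\<close> is negative. The fraction need not be in lowest terms, so the values of
  \<open>phi\<close> can be exhibited without reducing them.\<close>

definition denom_div :: "int \<Rightarrow> rat \<Rightarrow> bool" where
  "denom_div p x \<longleftrightarrow> (\<exists>a b. x = of_int a / of_int b \<and> b \<noteq> 0 \<and> p dvd b \<and> \<not> p dvd a)"

lemma denom_div_not_Ints:
  assumes "denom_div p x"
  shows "x \<notin> \<int>"
proof
  assume "x \<in> \<int>"
  then obtain n where n: "x = of_int n" by (auto elim: Ints_cases)
  from assms obtain a b where ab: "x = of_int a / of_int b" "b \<noteq> 0" "p dvd b" "\<not> p dvd a"
    unfolding denom_div_def by blast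
  have "(of_int a :: rat) = of_int (n * b)"
    using n ab by (simp add: field_simps)
  then have "a = n * b" by (simp only: of_int_eq_iff)
  with ab show False by simp
qed

text \<open>The cubic term dominates at \<open>p\<close>. After multiplying through by
  \<open>b ^ 3\<close> the numerator is congruent to \<open>r * s * a ^ 3\<close> modulo
  \<open>p\<close>, while the denominator keeps the factor \<open>b\<close>.\<close>

lemma denom_div_phi:
  assumes p: "prime p" and rs: "\<not> p dvd r * s" and x: "denom_div p x"
  shows "denom_div p (phi r s t x)"
proof -
  from x obtain a b where ab: "x = of_int a / of_int b" "b \<noteq> 0" "p dvd b" "\<not> p dvd a"
    unfolding denom_div_def by blast
  define a' where "a' = r * s * a ^ 3 + b * (s * a * b + t * b ^ 2)"
  define b' where "b' = b * (a ^ 2 + b ^ 2)"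
  have pos: "a ^ 2 + b ^ 2 > 0"
    using ab(2) by (simp add: sum_power2_gt_zero_iff)
  have pos': "(of_int a :: rat) ^ 2 + of_int b ^ 2 \<noteq> 0"
    using ab(2) by (simp add: sum_power2_eq_zero_iff)
  have "phi r s t x = of_int a' / of_int b'"
  proof -
    have d: "x ^ 2 + 1 = (of_int a ^ 2 + of_int b ^ 2) / of_int b ^ 2"
      using ab(2) by (simp add: ab(1) field_simps)
    have n: "of_int r * of_int s * x ^ 3 + of_int s * x + of_int t = of_int a' / of_int b ^ 3"
      using ab(2) by (simp add: ab(1) a'_def field_simps power2_eq_square power3_eq_cube)
    show ?thesis
      unfolding phi_def d n b'_def using ab(2) pos'
      by (simp add: divide_simps) (simp add: power2_eq_square power3_eq_cube algebra_simps)
  qed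
  moreover have "b' \<noteq> 0" using ab(2) pos by (simp add: b'_def)
  moreover have "p dvd b'" using ab(3) by (simp add: b'_def)
  moreover have "\<not> p dvd a'"
  proof
    assume "p dvd a'"
    then have "p dvd r * s * a ^ 3"
      using ab(3) unfolding a'_def by (metis dvd_add_left_iff dvd_mult2)
    then show False
      using p rs ab(4) by (metis prime_dvd_mult_iff prime_dvd_power)
  qed
  ultimately show ?thesis unfolding denom_div_def by blast
qed

text \<open>Any prime factor of the reduced denominator works. That it divides \<open>b\<close> is
  recorded because coprimality to \<open>r * s\<close> is later deduced from it.\<close>

lemma not_dvd_imp_denom_div:
  fixes a b :: int
  assumes "\<not> b dvd a" "b > 0"
  obtains p where "prime p" "p dvd b" "denom_div p (of_int a / of_int b)"
proof -
  define g where "g = gcd a b"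
  obtain a' b' where ab: "a = a' * g" "b = b' * g" "coprime a' b'"
    using assms(2) gcd_coprime_exists[of a b] unfolding g_def by auto
  have g: "g \<noteq> 0" and b': "b' \<noteq> 0" using assms(2) ab(2) by auto
  have "\<not> is_unit b'"
  proof
    assume "is_unit b'"
    then have "b dvd g" unfolding ab(2) by (simp add: mult_dvd_mono)
    then show False using assms(1) ab(1) by (auto intro: dvd_trans)
  qed
  then obtain p where p: "prime p" "p dvd b'"
    using prime_divisor_exists b' by blast
  have "\<not> p dvd a'"
    using p ab(3) by (meson coprime_common_divisor not_prime_unit)
  moreover have "(of_int a / of_int b :: rat) = of_int a' / of_int b'"
    using g by (simp add: ab)
  ultimately have "denom_div p (of_int a / of_int b)"
    unfolding denom_div_def using p b' by blast
  then show ?thesis using that p ab(2) by simp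
qed

section \<open>Non-integrality of the first iterate\<close>

text \<open>Modulo \<open>b\<^sup>2 + 1\<close> the numerator reduces to
  \<open>s * (1 - r) * b + t\<close>, which is linear in \<open>b\<close> and too small to be a
  nonzero multiple when \<open>b\<close> is large. If \<open>\<bar>r * s * t\<bar> = 1\<close>,
  divisibility gives no lower bound beyond 1 on \<open>\<bar>b\<bar>\<close>, and parity decides
  instead.\<close>

lemma not_dvd_numerator:
  fixes r s t b :: int
  assumes nz: "r \<noteq> 0" "s \<noteq> 0" "t \<noteq> 0" "b \<noteq> 0" and dvd: "(r * s * t) ^ 6 dvd b"
    and unit: "\<bar>r * s * t\<bar> = 1 \<Longrightarrow> \<bar>b\<bar> = 1"
  shows "\<not> b\<^sup>2 + 1 dvd r * s * b ^ 3 + s * b + t"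
proof
  assume "b\<^sup>2 + 1 dvd r * s * b ^ 3 + s * b + t"
  moreover have "r * s * b ^ 3 + s * b + t = r * s * b * (b\<^sup>2 + 1) + (s * (1 - r) * b + t)"
    by (simp add: algebra_simps power2_eq_square power3_eq_cube)
  ultimately have M: "b\<^sup>2 + 1 dvd s * (1 - r) * b + t"
    by (metis dvd_add_right_iff dvd_triv_right)
  define A where "A = \<bar>r * s * t\<bar>"
  have A1: "A \<ge> 1" using nz unfolding A_def by (smt (verit) mult_eq_0_iff)
  have rA: "\<bar>r\<bar> \<le> A" and sA: "\<bar>s\<bar> \<le> A" and tA: "\<bar>t\<bar> \<le> A"
    using nz unfolding A_def by (auto intro!: dvd_imp_le_int)
  show False
  proof (cases "A = 1")
    case True
    then have b: "\<bar>b\<bar> = 1" using unit A_def by simp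
    \<comment> \<open>Here \<open>b\<^sup>2 + 1 = 2\<close>, whereas \<open>1 - r\<close> is even
      and \<open>t\<close> is odd, so the remainder is odd.\<close>
    have odds: "odd r" "odd s" "odd t" "b\<^sup>2 = 1"
      using True rA sA tA nz b by (auto simp: abs_if split: if_splits)
    then have "odd (s * (1 - r) * b + t)" by simp
    moreover have "2 dvd s * (1 - r) * b + t" using M odds(4) by simp
    ultimately show False by simp
  next
    case False
    then have A2: "A \<ge> 2" using A1 by simp
    have "\<bar>(r * s * t) ^ 6\<bar> \<le> \<bar>b\<bar>" using dvd nz(4) by (intro dvd_imp_le_int)
    then have bA: "A ^ 6 \<le> \<bar>b\<bar>" by (simp add: A_def power_abs)
    \<comment> \<open>The quantity \<open>A\<^sup>2 + 2 * A = A * (1 + A) + A\<close> is the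
      coefficient of \<open>\<bar>b\<bar>\<close> in the estimate of the remainder below.\<close>
    have "A ^ 3 \<ge> A\<^sup>2 + 2 * A"
    proof -
      have "A\<^sup>2 + 2 * A \<le> A\<^sup>2 + A\<^sup>2"
        using A2 by (simp add: power2_eq_square)
      also have "\<dots> \<le> A * A\<^sup>2" using A2 mult_right_mono[of 2 A "A\<^sup>2"] by simp
      finally show ?thesis by (simp add: power2_eq_square power3_eq_cube)
    qed
    moreover have "A ^ 6 > A ^ 3" using A2 by (intro power_strict_increasing) auto
    moreover have "A\<^sup>2 \<ge> 0" by simp
    ultimately have big: "A\<^sup>2 + 2 * A < \<bar>b\<bar>" "A < \<bar>b\<bar>" using bA A2 by linarith+
    have "\<bar>s * (1 - r) * b + t\<bar> \<le> \<bar>s\<bar> * \<bar>1 - r\<bar> * \<bar>b\<bar> + \<bar>t\<bar>"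
      by (metis abs_mult abs_triangle_ineq)
    also have "\<dots> \<le> A * (1 + A) * \<bar>b\<bar> + A * \<bar>b\<bar>"
    proof (rule add_mono)
      show "\<bar>s\<bar> * \<bar>1 - r\<bar> * \<bar>b\<bar> \<le> A * (1 + A) * \<bar>b\<bar>"
        using rA sA A1 by (intro mult_right_mono mult_mono) auto
      have "A * 1 \<le> A * \<bar>b\<bar>" using A2 big by (intro mult_left_mono) auto
      then show "\<bar>t\<bar> \<le> A * \<bar>b\<bar>" using tA by simp
    qed
    also have "\<dots> = (A\<^sup>2 + 2 * A) * \<bar>b\<bar>" by (simp add: algebra_simps power2_eq_square)
    also have "\<dots> \<le> \<bar>b\<bar> * \<bar>b\<bar>" using big by (intro mult_right_mono) auto
    also have "\<dots> < b\<^sup>2 + 1" by (simp add: power2_eq_square)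
    finally have "\<bar>s * (1 - r) * b + t\<bar> < b\<^sup>2 + 1" .
    with M have M0: "s * (1 - r) * b + t = 0"
      using dvd_imp_le_int[of "s * (1 - r) * b + t" "b\<^sup>2 + 1"] by fastforce
    \<comment> \<open>If \<open>r = 1\<close>, the vanishing remainder would be \<open>t\<close>
      itself. Otherwise it forces \<open>\<bar>b\<bar> \<le> \<bar>t\<bar> \<le> A\<close>, against
      the size of \<open>b\<close>.\<close>
    with nz have "s * (1 - r) \<noteq> 0" by auto
    then have "\<bar>s * (1 - r)\<bar> \<ge> 1" by linarith
    then have "1 * \<bar>b\<bar> \<le> \<bar>s * (1 - r)\<bar> * \<bar>b\<bar>" by (intro mult_right_mono) auto
    also have "\<dots> = \<bar>t\<bar>" using M0 by (simp add: abs_mult[symmetric] eq_neg_iff_add_eq_0[symmetric])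
    finally show False using big tA by simp
  qed
qed

lemma forward_orbit_closed:
  assumes "b \<in> S" "\<And>x. x \<in> S \<Longrightarrow> f x \<in> S"
  shows "forward_orbit f b \<subseteq> S"
proof -
  have "(f ^^ n) b \<in> S" for n by (induction n) (auto intro: assms)
  then show ?thesis by (auto simp: forward_orbit_def)
qed

lemma forward_orbit_insert: "forward_orbit f b \<subseteq> insert b (forward_orbit f (f b))"
proof
  fix y assume "y \<in> forward_orbit f b"
  then obtain n where n: "y = (f ^^ n) b" by (auto simp: forward_orbit_def)
  show "y \<in> insert b (forward_orbit f (f b))"
    using n by (cases n) (auto simp: forward_orbit_def funpow_swap1)
qed

lemma forward_orbit_phi_Ints_subset:
  fixes r s t b :: int
  assumes nz: "r \<noteq> 0" "s \<noteq> 0" "t \<noteq> 0" "b \<noteq> 0" and dvd: "(r * s * t) ^ 6 dvd b"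
    and unit: "\<bar>r * s * t\<bar> = 1 \<Longrightarrow> \<bar>b\<bar> = 1"
  shows "forward_orbit (phi r s t) (of_int b) \<inter> \<int> \<subseteq> {of_int b}"
proof -
  have "b\<^sup>2 + 1 > 0" by (simp add: add_nonneg_pos)
  then obtain p where p: "prime p" "p dvd b\<^sup>2 + 1"
      "denom_div p (of_int (r * s * b ^ 3 + s * b + t) / of_int (b\<^sup>2 + 1))"
    using not_dvd_imp_denom_div not_dvd_numerator[OF assms] by blast
  \<comment> \<open>A prime dividing \<open>r * s\<close> divides \<open>b\<close>, hence cannot
    divide \<open>b\<^sup>2 + 1\<close>.\<close>
  have "\<not> p dvd r * s"
  proof
    assume "p dvd r * s"
    then have "p dvd (r * s * t) ^ 6" by (simp add: dvd_power_le[of p _ 1 6, simplified])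
    then have "p dvd b\<^sup>2" using dvd by (metis dvd_mult2 dvd_trans power2_eq_square)
    then have "p dvd 1" using p(2) by (simp add: dvd_add_right_iff)
    then show False using p(1) by (simp add: not_prime_unit)
  qed
  moreover have "phi r s t (of_int b) = of_int (r * s * b ^ 3 + s * b + t) / of_int (b\<^sup>2 + 1)"
    by (simp add: phi_def)
  ultimately have "forward_orbit (phi r s t) (phi r s t (of_int b)) \<subseteq> {x. denom_div p x}"
    using p by (intro forward_orbit_closed) (auto intro: denom_div_phi)
  then show ?thesis
    using forward_orbit_insert[of "phi r s t" "of_int b"] denom_div_not_Ints by blast
qed

section \<open>Counting integer points on a single orbit\<close>

lemma num_points_le_card:
  assumes "A \<subseteq> S" "finite S" "card S \<le> n"
  shows "num_points A \<le> of_nat n"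
proof -
  have "finite A" using assms finite_subset by blast
  then have "num_points A = of_nat (card A)"
    by (simp add: num_points_def)
  also have "card A \<le> n" using assms card_mono le_trans by blast
  finally show ?thesis by (simp add: of_nat_mono)
qed

text \<open>The cubic term disappears, and both \<open>\<bar>x\<bar>\<close> and 1 are at most
  \<open>x\<^sup>2 + 1\<close>.\<close>

lemma abs_phi_le:
  assumes "r * s = 0"
  shows "\<bar>phi r s t x\<bar> \<le> of_int (\<bar>s\<bar> + \<bar>t\<bar>)"
proof -
  have pos: "x\<^sup>2 + 1 > 0" by (simp add: add_nonneg_pos)
  have x: "\<bar>x\<bar> \<le> x\<^sup>2 + 1"
  proof (cases "\<bar>x\<bar> \<le> 1")
    case False
    then have "\<bar>x\<bar> * 1 \<le> \<bar>x\<bar> * \<bar>x\<bar>" by (intro mult_left_mono) auto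
    then show ?thesis by (simp add: power2_eq_square)
  qed (simp add: add_increasing)
  have "(of_int r * of_int s :: rat) = 0" using assms by auto
  then have "\<bar>phi r s t x\<bar> = \<bar>of_int s * x + of_int t\<bar> / (x\<^sup>2 + 1)"
    using pos by (auto simp: phi_def abs_divide)
  moreover have "\<bar>of_int s * x + of_int t\<bar> \<le> of_int \<bar>s\<bar> * \<bar>x\<bar> + of_int \<bar>t\<bar> * 1"
    by (metis abs_mult abs_triangle_ineq mult.right_neutral of_int_abs)
  moreover have "\<dots> \<le> of_int \<bar>s\<bar> * (x\<^sup>2 + 1) + of_int \<bar>t\<bar> * (x\<^sup>2 + 1)"
    using x by (intro add_mono mult_left_mono) auto
  ultimately show ?thesis using pos by (simp add: divide_le_eq algebra_simps)
qed

text \<open>The orbit never leaves the interval from \<open>-2B\<close> to \<open>2B\<close>, which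
  contains \<open>4 * B + 1\<close> integers.\<close>

lemma num_points_orbit_zero_le:
  assumes "r * s = 0" "\<bar>s\<bar> \<le> int B" "\<bar>t\<bar> \<le> int B"
  shows "num_points (forward_orbit (phi r s t) 0 \<inter> \<int>) \<le> of_nat (4 * B + 1)"
proof (rule num_points_le_card)
  let ?S = "of_int ` {- (2 * int B)..2 * int B} :: rat set"
  have "forward_orbit (phi r s t) 0 \<subseteq> {x. \<bar>x\<bar> \<le> of_int (2 * int B)}"
  proof (rule forward_orbit_closed)
    have "(of_int (\<bar>s\<bar> + \<bar>t\<bar>) :: rat) \<le> of_int (2 * int B)"
      using assms by (subst of_int_le_iff) linarith
    then show "phi r s t x \<in> {x. \<bar>x\<bar> \<le> of_int (2 * int B)}" for x
      using abs_phi_le[OF assms(1), of t x] by (auto intro: order_trans)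
  qed simp
  moreover have "x \<in> ?S" if "x \<in> \<int>" "\<bar>x\<bar> \<le> of_int (2 * int B)" for x :: rat
  proof -
    from that(1) obtain k where k: "x = of_int k" by (auto elim: Ints_cases)
    with that(2) have "of_int \<bar>k\<bar> \<le> (of_int (2 * int B) :: rat)" by simp
    then have "\<bar>k\<bar> \<le> 2 * int B" by (simp only: of_int_le_iff)
    then have "k \<in> {- (2 * int B)..2 * int B}" by auto
    then show ?thesis using k by blast
  qed
  ultimately show "forward_orbit (phi r s t) 0 \<inter> \<int> \<subseteq> ?S" by blast
  have "card ?S \<le> card {- (2 * int B)..2 * int B}" by (intro card_image_le) simp
  then show "card ?S \<le> 4 * B + 1" by simp
qed simp

text \<open>The bound adds separate contributions from the planes \<open>r = 0\<close> and
  \<open>s = 0\<close>, so that it can be summed term by term; the leading 1 covers all remaining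
  triples, including those with \<open>t = 0\<close>.\<close>

lemma num_points_orbit_beta_le:
  assumes n: "n1 \<ge> 6" "n2 \<ge> 6" "n3 \<ge> 6" and B: "\<bar>s\<bar> \<le> int B" "\<bar>t\<bar> \<le> int B"
  shows "num_points (forward_orbit (phi r s t) (beta n1 n2 n3 r s t) \<inter> \<int>)
    \<le> of_nat (1 + (if r = 0 then 4 * B + 1 else 0) + (if s = 0 then 4 * B + 1 else 0))"
proof -
  \<comment> \<open>The exponents are positive, so \<open>nat\<close> loses nothing and
    \<open>beta\<close> is an integer.\<close>
  define b where "b = r ^ nat n1 * s ^ nat n2 * t ^ nat n3"
  have beta: "beta n1 n2 n3 r s t = of_int b"
    using n by (simp add: beta_def b_def power_int_def)
  consider "r * s = 0" | "r * s \<noteq> 0" "t = 0" | "r \<noteq> 0" "s \<noteq> 0" "t \<noteq> 0" by auto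
  then show ?thesis
  proof cases
    case 1
    then have "b = 0" using n by (auto simp: b_def)
    then have "num_points (forward_orbit (phi r s t) (beta n1 n2 n3 r s t) \<inter> \<int>) \<le> of_nat (4 * B + 1)"
      using num_points_orbit_zero_le[OF 1 B] by (simp add: beta)
    also have "\<dots> \<le> of_nat (1 + (if r = 0 then 4 * B + 1 else 0) + (if s = 0 then 4 * B + 1 else 0))"
      using 1 by (intro of_nat_mono) auto
    finally show ?thesis .
  next
    case 2
    then have "b = 0" using n by (auto simp: b_def)
    \<comment> \<open>For \<open>t = 0\<close> the point 0 is fixed by \<open>phi\<close>.\<close>
    then have "forward_orbit (phi r s t) (of_int b) \<subseteq> {0}"
      using 2 by (intro forward_orbit_closed) (auto simp: phi_def)
    then show ?thesis unfolding beta by (intro num_points_le_card[of _ "{0}"]) auto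
  next
    case 3
    have "b \<noteq> 0" using 3 by (simp add: b_def)
    moreover have "(r * s * t) ^ 6 dvd b"
      unfolding b_def power_mult_distrib using n by (intro mult_dvd_mono le_imp_power_dvd) auto
    moreover have "\<bar>b\<bar> = 1" if "\<bar>r * s * t\<bar> = 1"
    proof -
      have "\<bar>r\<bar> = 1" "\<bar>s\<bar> = 1" "\<bar>t\<bar> = 1"
        using that abs_zmult_eq_1[of "r * s" t] abs_zmult_eq_1[of t "r * s"]
          abs_zmult_eq_1[of r s] abs_zmult_eq_1[of s r] by (simp_all add: mult.commute)
      then show ?thesis by (simp add: b_def abs_mult power_abs)
    qed
    ultimately have "forward_orbit (phi r s t) (of_int b) \<inter> \<int> \<subseteq> {of_int b}"
      using 3 by (intro forward_orbit_phi_Ints_subset)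
    then show ?thesis unfolding beta by (intro num_points_le_card[of _ "{of_int b}"]) auto
  qed
qed

section \<open>Summation over the box\<close>

text \<open>Each of the two planes contains \<open>(2 * B + 1) ^ 2\<close> triples of extra weight
  \<open>4 * B + 1 \<le> 2 * (2 * B + 1)\<close>. Together with the weight 1 everywhere this gives
  the constant \<open>1 + 2 + 2 = 5\<close>.\<close>

lemma sum_axis_weights_le:
  "(\<Sum>r\<in>{-int B..int B}. \<Sum>s\<in>{-int B..int B}. \<Sum>t\<in>{-int B..int B}.
      1 + (if r = 0 then 4 * B + 1 else 0) + (if s = 0 then 4 * B + 1 else 0))
    \<le> 5 * (2 * B + 1) ^ 3"
proof -
  let ?I = "{-int B..int B}"
  have c: "card ?I = 2 * B + 1" by simp
  have d: "(\<Sum>r\<in>?I. if r = 0 then k else 0) = k" for k :: nat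
    by (simp add: sum.delta)
  have "(\<Sum>r\<in>?I. \<Sum>s\<in>?I. \<Sum>t\<in>?I.
      1 + (if r = 0 then 4 * B + 1 else 0) + (if s = 0 then 4 * B + 1 else 0))
    = (2 * B + 1) ^ 3 + 2 * (4 * B + 1) * (2 * B + 1) ^ 2"
    by (simp only: sum.distrib sum_constant c d sum_distrib_left[symmetric] of_nat_id)
       (simp add: algebra_simps power2_eq_square power3_eq_cube)
  also have "\<dots> \<le> (2 * B + 1) ^ 3 + 2 * (2 * (2 * B + 1)) * (2 * B + 1) ^ 2"
    by (intro add_mono mult_right_mono mult_left_mono) auto
  also have "\<dots> = 5 * (2 * B + 1) ^ 3"
    by (simp add: power2_eq_square power3_eq_cube algebra_simps)
  finally show ?thesis .
qed

theorem theorem3p7: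
  fixes n1 n2 n3 :: int
  assumes "Min {n1, n2, n3} \<ge> 6"
  shows "limsup (\<lambda>B::nat.
           (\<Sum>r\<in>{-int B..int B}. \<Sum>s\<in>{-int B..int B}. \<Sum>t\<in>{-int B..int B}.
              num_points (forward_orbit (phi r s t) (beta n1 n2 n3 r s t) \<inter> \<int>))
           / (2 * of_nat B + 1) ^ 3) < \<infinity>"
proof -
  have n: "n1 \<ge> 6" "n2 \<ge> 6" "n3 \<ge> 6" using assms by auto
  \<comment> \<open>The average is at most 5 for every \<open>B\<close>, which bounds the limsup
    directly.\<close>
  have "(\<Sum>r\<in>{-int B..int B}. \<Sum>s\<in>{-int B..int B}. \<Sum>t\<in>{-int B..int B}.
              num_points (forward_orbit (phi r s t) (beta n1 n2 n3 r s t) \<inter> \<int>))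
           / (2 * of_nat B + 1) ^ 3 \<le> 5" (is "?S / _ \<le> _") for B :: nat
  proof -
    have "?S \<le> (\<Sum>r\<in>{-int B..int B}. \<Sum>s\<in>{-int B..int B}. \<Sum>t\<in>{-int B..int B}.
        of_nat (1 + (if r = 0 then 4 * B + 1 else 0) + (if s = 0 then 4 * B + 1 else 0)))"
      by (intro sum_mono num_points_orbit_beta_le n) auto
    also have "\<dots> \<le> of_nat (5 * (2 * B + 1) ^ 3)"
      unfolding of_nat_sum[symmetric] by (intro of_nat_mono sum_axis_weights_le)
    also have "\<dots> = 5 * (2 * of_nat B + 1) ^ 3" by (simp add: add.commute)
    finally have le: "?S \<le> 5 * (2 * of_nat B + 1) ^ 3" .
    show ?thesis
    proof (rule divide_le_posI_ennreal)
      show "?S \<le> (2 * of_nat B + 1) ^ 3 * 5" using le by (simp only: mult.commute)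
    qed (simp add: zero_less_iff_neq_zero)
  qed
  then have "limsup (\<lambda>B::nat.
           (\<Sum>r\<in>{-int B..int B}. \<Sum>s\<in>{-int B..int B}. \<Sum>t\<in>{-int B..int B}.
              num_points (forward_orbit (phi r s t) (beta n1 n2 n3 r s t) \<inter> \<int>))
           / (2 * of_nat B + 1) ^ 3) \<le> 5"
    by (intro Limsup_bounded always_eventually allI)
  also have "(5 :: ennreal) < \<infinity>" by simp
  finally show ?thesis .
qed

end
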